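(* Suppose: the system operates in a compact domain $\mathcal{X}_{\mathrm{op}}$ with obstacle distance $d\in[d_{\min},d_{\max}]$, $d_{\min}>0$, relative heading $\Delta\theta\in[0,\pi]$, and $\gamma\in\Gamma:=[\gamma_{\min},\gamma_{\max}]^2$ with $\gamma_{\min}>0$; the margin $\psi(\gamma)=\ddot h+(\gamma_0+\gamma_1)\dot h+\gamma_0\gamma_1h$ is $L_\psi$-Lipschitz in $\gamma$ on $\Gamma$; parameters are chosen by the smooth soft-max selector of the context, with $\gamma^*_{\hat\Phi}$ and $\gamma^*_\Phi$ the parameters selected from the learned predictor $\hat\Phi_\theta$ and the true safety loss $\Phi$; and $\|\hat\Phi_\theta-\Phi\|_\infty\le\epsilon$ on $\mathcal{X}_{\mathrm{op}}\times\Gamma$. Let $L_{\mathcal{M}}=\kappa\sqrt2(\gamma_{\max}-\gamma_{\min})$. Define the CBF-QP constraint function $$\Psi(x,\gamma,u):=L_f^2h(x)+L_gL_fh(x)u+(\gamma_0+\gamma_1)\big(L_fh(x)+L_gh(x)u\big)+\gamma_0\gamma_1h(x).$$ Suppose the CBF-QP is feasible under $\gamma^*_\Phi$ with margin $\mu(x):=\max_{u\in\mathcal{U}}\Psi(x,\gamma^*_\Phi,u)>0$, and that $\Psi$ is $L_\Psi$-Lipschitz in $\gamma$ uniformly over $\mathcal{U}$: $$|\Psi(x,\gamma,u)-\Psi(x,\gamma',u)|\le L_\Psi\|\gamma-\gamma'\|,\qquad\forall u\in\mathcal{U}.$$ Then the CBF-QP is feasible under $\gamma^*_{\hat\Phi}$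 whenever $$L_\Psi\,L_{\mathcal{M}}\,\epsilon<\inf_{x\in\mathcal{X}_{\mathrm{op}}}\mu(x).$$
   Context: System: $\dot x=f(x)+g(x)u$, $x\in\mathcal{X}\subset\mathbb{R}^n$, $u\in\mathcal{U}\subset\mathbb{R}^m$; $h$ is a barrier function, $L_f,L_g$ denote Lie derivatives, $\gamma=(\gamma_0,\gamma_1)$. The CBF-QP at state $x$ with parameter $\gamma$ minimizes $\|u-u_{\mathrm{nom}}\|^2$ over $u\in\mathcal{U}$ subject to $\Psi(x,\gamma,u)\ge0$; it is feasible at $x$ if some $u\in\mathcal{U}$ satisfies this constraint, and "feasible under $\gamma^*$" means feasible with $\gamma=\gamma^*(x)$ at every $x\in\mathcal{X}_{\mathrm{op}}$. Safety loss: $\Phi(x,x_{\mathrm{obs}},\gamma)=\lambda_1e^{-\lambda_2\psi}/(\beta_1e^{-\beta_2(\cos\Delta\theta+1)}d^2+1)$, with $d$ the distance to the obstacle $x_{\mathrm{obs}}$, $\Delta\theta$ the relative heading angle, and $\lambda_1,\lambda_2,\beta_1,\beta_2$ design parameters. $\hat\Phi_\theta(s,\gamma)$ is a learned real-valued predictor of $\Phi$, with $s$ the relative-state encoding of $x$; both are regarded as functions of $(x,\gamma)$. Smooth selector: with a finite candidate set $\Gamma_{\mathrm{cand}}\subset\Gamma$, for a loss function $F$ (either $\hat\Phi_\theta$ or $\Phi$), $$\gamma^*_F(s)=\frac{\sum_{\gamma\in\Gamma_{\mathrm{cand}}}\gamma\,w(\gamma,s)}{\sum_{\gamma\in\Gamma_{\mathrm{cand}}}w(\gamma,s)},\qquad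 w(\gamma,s)=\exp\big(J(\gamma)/\tau_s-\kappa\,\mathrm{softplus}(F(s,\gamma))\big),$$ where $J$ is a real-valued criterion, $\tau_s>0$, $\kappa>0$, and $\mathrm{softplus}(y)=\ln(1+e^y)$. *)

theory Defs
  imports "HOL-Analysis.Analysis"
begin

text \<open>A control-affine system has drift \<open>f\<close> and input matrix \<open>g\<close>, where \<open>g x\<close> is an
  \<open>n \<times> m\<close> matrix. The pair \<open>\<gamma> = (\<gamma>\<^sub>0, \<gamma>\<^sub>1)\<close> lives in \<^typ>\<open>real \<times> real\<close>, whose norm is the
  Euclidean one.\<close>

definition lie_derivative ::
    "(real^'n \<Rightarrow> real^'n) \<Rightarrow> (real^'n \<Rightarrow> real) \<Rightarrow> real^'n \<Rightarrow> real" where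
  "lie_derivative f h x = frechet_derivative h (at x) (f x)"

text \<open>The row vector \<open>L\<^sub>g h(x)\<close> of Lie derivatives along the columns of \<open>g\<close>; its product with
  an input \<open>u\<close> is \<open>lie_derivative_input g h x \<bullet> u\<close>.\<close>

definition lie_derivative_input ::
    "(real^'n \<Rightarrow> real^'m^'n) \<Rightarrow> (real^'n \<Rightarrow> real) \<Rightarrow> real^'n \<Rightarrow> real^'m" where
  "lie_derivative_input g h x = (\<chi> j. lie_derivative (\<lambda>y. column j (g y)) h x)"

definition cbf_constraint ::
    "(real^'n \<Rightarrow> real^'n) \<Rightarrow> (real^'n \<Rightarrow> real^'m^'n) \<Rightarrow> (real^'n \<Rightarrow> real)
      \<Rightarrow> real^'n \<Rightarrow> real \<times> real \<Rightarrow> real^'m \<Rightarrow> real" where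
  "cbf_constraint f g h x \<gamma> u =
     lie_derivative f (lie_derivative f h) x
     + lie_derivative_input g (lie_derivative f h) x \<bullet> u
     + (fst \<gamma> + snd \<gamma>) * (lie_derivative f h x + lie_derivative_input g h x \<bullet> u)
     + fst \<gamma> * snd \<gamma> * h x"

text \<open>Feasibility of a quadratic program does not involve its objective, so the nominal input
  does not occur here.\<close>

definition cbf_qp_feasible ::
    "(real^'n \<Rightarrow> real^'n) \<Rightarrow> (real^'n \<Rightarrow> real^'m^'n) \<Rightarrow> (real^'n \<Rightarrow> real) \<Rightarrow> (real^'m) set
      \<Rightarrow> real^'n \<Rightarrow> real \<times> real \<Rightarrow> bool" where
  "cbf_qp_feasible f g h U x \<gamma> \<longleftrightarrow> (\<exists>u\<in>U. cbf_constraint f g h x \<gamma> u \<ge> 0)"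

definition cbf_qp_feasible_under ::
    "(real^'n \<Rightarrow> real^'n) \<Rightarrow> (real^'n \<Rightarrow> real^'m^'n) \<Rightarrow> (real^'n \<Rightarrow> real) \<Rightarrow> (real^'m) set
      \<Rightarrow> (real^'n) set \<Rightarrow> (real^'n \<Rightarrow> real \<times> real) \<Rightarrow> bool" where
  "cbf_qp_feasible_under f g h U Xop gs \<longleftrightarrow> (\<forall>x\<in>Xop. cbf_qp_feasible f g h U x (gs x))"

text \<open>The maximum of the constraint function over the inputs; meaningful only if it is attained
  (\<^const>\<open>Max\<close> would be restricted to finite sets).\<close>

definition cbf_margin ::
    "(real^'n \<Rightarrow> real^'n) \<Rightarrow> (real^'n \<Rightarrow> real^'m^'n) \<Rightarrow> (real^'n \<Rightarrow> real) \<Rightarrow> (real^'m) set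
      \<Rightarrow> real^'n \<Rightarrow> real \<times> real \<Rightarrow> real" where
  "cbf_margin f g h U x \<gamma> = (GREATEST y. y \<in> cbf_constraint f g h x \<gamma> ` U)"

text \<open>\<open>\<xi>\<close> is a motion of the system near time 0, driven by the admissible input signal \<open>\<upsilon>\<close>,
  that passes through \<open>x\<close> at time 0.\<close>

definition trajectory_through ::
    "(real^'n \<Rightarrow> real^'n) \<Rightarrow> (real^'n \<Rightarrow> real^'m^'n) \<Rightarrow> (real^'m) set \<Rightarrow> real^'n
      \<Rightarrow> (real \<Rightarrow> real^'n) \<Rightarrow> (real \<Rightarrow> real^'m) \<Rightarrow> bool" where
  "trajectory_through f g U x \<xi> \<upsilon> \<longleftrightarrow>
     \<xi> 0 = x \<and>
     (\<forall>\<^sub>F t in nhds 0. \<upsilon> t \<in> U \<and> (\<xi> has_vector_derivative f (\<xi> t) + g (\<xi> t) *v \<upsilon> t) (at t))"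

text \<open>The margin \<open>\<psi>\<close> at the state \<open>\<xi> 0\<close>: the time derivatives of \<open>h\<close> are taken along \<open>\<xi>\<close>.\<close>

definition safety_margin ::
    "(real^'n \<Rightarrow> real) \<Rightarrow> (real \<Rightarrow> real^'n) \<Rightarrow> real \<times> real \<Rightarrow> real" where
  "safety_margin h \<xi> \<gamma> =
     deriv (deriv (\<lambda>t. h (\<xi> t))) 0
     + (fst \<gamma> + snd \<gamma>) * deriv (\<lambda>t. h (\<xi> t)) 0
     + fst \<gamma> * snd \<gamma> * h (\<xi> 0)"

definition safety_loss ::
    "real \<Rightarrow> real \<Rightarrow> real \<Rightarrow> real \<Rightarrow> real \<Rightarrow> real \<Rightarrow> real \<Rightarrow> real" where
  "safety_loss lam1 lam2 \<beta>\<^sub>1 \<beta>\<^sub>2 \<psi> d \<Delta>\<theta> =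
     lam1 * exp (- lam2 * \<psi>) / (\<beta>\<^sub>1 * exp (- \<beta>\<^sub>2 * (cos \<Delta>\<theta> + 1)) * d\<^sup>2 + 1)"

definition softplus :: "real \<Rightarrow> real" where
  "softplus y = ln (1 + exp y)"

definition selector_weight ::
    "(real \<times> real \<Rightarrow> real) \<Rightarrow> real \<Rightarrow> real \<Rightarrow> ('x \<Rightarrow> real \<times> real \<Rightarrow> real)
      \<Rightarrow> real \<times> real \<Rightarrow> 'x \<Rightarrow> real" where
  "selector_weight J \<tau> \<kappa> F \<gamma> x = exp (J \<gamma> / \<tau> - \<kappa> * softplus (F x \<gamma>))"

definition smooth_selector ::
    "(real \<times> real) set \<Rightarrow> (real \<times> real \<Rightarrow> real) \<Rightarrow> real \<Rightarrow> real
      \<Rightarrow> ('x \<Rightarrow> real \<times> real \<Rightarrow> real) \<Rightarrow> 'x \<Rightarrow> real \<times> real" where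
  "smooth_selector C J \<tau> \<kappa> F x =
     (\<Sum>\<gamma>\<in>C. selector_weight J \<tau> \<kappa> F \<gamma> x *\<^sub>R \<gamma>) /\<^sub>R (\<Sum>\<gamma>\<in>C. selector_weight J \<tau> \<kappa> F \<gamma> x)"

text \<open>Extended-real valued, so that a bound by a real number includes boundedness.\<close>

definition sup_norm_on :: "'a set \<Rightarrow> ('a \<Rightarrow> real) \<Rightarrow> ereal" where
  "sup_norm_on S F = (SUP z\<in>S. ereal \<bar>F z\<bar>)"

end

theory Submission
  imports Defs
begin

text \<open>The selected parameter is a softmax average of the candidates. Softplus is 1-Lipschitz, so an
  error \<open>\<epsilon>\<close> in the loss moves every logit by at most \<open>\<delta> = \<kappa> \<epsilon>\<close> and every log-probability by at
  most \<open>2 \<delta>\<close>. As the logarithmic mean is at most the arithmetic mean, the probability vectors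
  differ by at most \<open>2 \<delta>\<close> in the 1-norm. Measuring the candidates from the centre of the square
  \<open>\<Gamma>\<close>, whose circumradius is \<open>(\<gamma>_max - \<gamma>_min) / sqrt 2\<close>, turns this into a displacement of at most
  \<open>L_M \<epsilon>\<close>. The input that maximises the constraint at the true parameter then loses less than the
  margin, so it stays admissible at the predicted one.\<close>

section \<open>Logarithmic and arithmetic means\<close>

text \<open>\<open>exp\<close> is convex, so the trapezoid rule overestimates its integral from
  \<open>b\<close> to \<open>a\<close>.\<close>

lemma exp_diff_le_trapezoid:
  fixes a b :: real
  assumes "b \<le> a"
  shows "exp a - exp b \<le> (a - b) * ((exp a + exp b) / 2)"
proof -
  \<comment> \<open>Dividing the claim by \<open>exp b\<close> leaves the single variable
    \<open>x = a - b\<close>; \<open>G x\<close> is then the right side minus the left side, and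
    \<open>G 0 = 0\<close>.\<close>
  define G where "G = (\<lambda>x::real. x * ((exp x + 1) / 2) - exp x + 1)"
  have "G 0 \<le> G (a - b)"
  proof (rule DERIV_nonneg_imp_nondecreasing[where f = G])
    fix x :: real
    have D: "(G has_real_derivative (exp x + 1) / 2 + x * exp x / 2 - exp x) (at x)"
      unfolding G_def by (auto intro!: derivative_eq_intros simp: field_simps)
    \<comment> \<open>The derivative of \<open>G\<close> is half of
      \<open>1 - exp x * (1 - x)\<close>, so its sign follows from
      \<open>1 - x \<le> exp (- x)\<close>.\<close>
    have "exp x * (1 - x) \<le> exp x * exp (- x)"
      using exp_ge_add_one_self[of "- x"] by (intro mult_left_mono) auto
    then have "exp x * (1 - x) \<le> 1"
      by (simp add: exp_minus field_simps)
    then have "0 \<le> (exp x + 1) / 2 + x * exp x / 2 - exp x"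
      by (simp add: field_simps)
    with D show "\<exists>y. (G has_real_derivative y) (at x) \<and> 0 \<le> y" by blast
  qed (use assms in simp)
  then have "0 \<le> exp b * G (a - b)"
    by (simp add: G_def)
  also have "exp b * exp (a - b) = exp a"
    by (simp flip: exp_add)
  then have "exp b * G (a - b) = (a - b) * ((exp a + exp b) / 2) - exp a + exp b"
    unfolding G_def by (simp add: field_simps)
  finally show ?thesis by simp
qed

text \<open>The comparison of the two means, multiplied out so that \<open>p = q\<close> needs no
  exception.\<close>

lemma abs_diff_le_log_diff_mult_mean:
  fixes p q :: real
  assumes "p > 0" "q > 0"
  shows "\<bar>p - q\<bar> \<le> \<bar>ln p - ln q\<bar> * ((p + q) / 2)"
proof (cases "q \<le> p")
  case True
  then show ?thesis
    using exp_diff_le_trapezoid[of "ln q" "ln p"] assms by simp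
next
  case False
  then show ?thesis
    using exp_diff_le_trapezoid[of "ln p" "ln q"] assms by (simp add: add.commute)
qed

section \<open>Softmax averages under perturbed logits\<close>

text \<open>A common shift of the exponents leaves log-sum-exp as a summand. Used in both
  directions, this controls the log normaliser of a softmax.\<close>

lemma ln_sum_exp_diff_le:
  fixes a b :: "'i \<Rightarrow> real"
  assumes "finite I" "I \<noteq> {}" and "\<And>i. i \<in> I \<Longrightarrow> a i \<le> b i + \<delta>"
  shows "ln (\<Sum>i\<in>I. exp (a i)) \<le> ln (\<Sum>i\<in>I. exp (b i)) + \<delta>"
proof -
  have pos: "0 < (\<Sum>i\<in>I. exp (c i))" for c :: "'i \<Rightarrow> real"
    using assms by (intro sum_pos) auto
  have "(\<Sum>i\<in>I. exp (a i)) \<le> (\<Sum>i\<in>I. exp (b i) * exp \<delta>)"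
    using assms(3) by (intro sum_mono) (simp flip: exp_add)
  also have "\<dots> = (\<Sum>i\<in>I. exp (b i)) * exp \<delta>"
    by (simp add: sum_distrib_right)
  finally have "ln (\<Sum>i\<in>I. exp (a i)) \<le> ln ((\<Sum>i\<in>I. exp (b i)) * exp \<delta>)"
    using pos by (subst ln_le_cancel_iff) auto
  then show ?thesis
    using pos[of b] by (simp add: ln_mult)
qed

definition softmax :: "'i set \<Rightarrow> ('i \<Rightarrow> real) \<Rightarrow> 'i \<Rightarrow> real" where
  "softmax I a i = exp (a i) / (\<Sum>j\<in>I. exp (a j))"

lemma softmax_pos:
  assumes "finite I" "I \<noteq> {}"
  shows "softmax I a i > 0"
  using assms by (auto simp: softmax_def intro!: divide_pos_pos sum_pos)

lemma sum_softmax: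
  assumes "finite I" "I \<noteq> {}"
  shows "(\<Sum>i\<in>I. softmax I a i) = 1"
proof -
  have "0 < (\<Sum>j\<in>I. exp (a j))"
    using assms by (intro sum_pos) auto
  then show ?thesis
    by (simp add: softmax_def flip: sum_divide_distrib)
qed

text \<open>The logit and the log normaliser each contribute \<delta> to the change of a
  log-probability. The mean of the two probability vectors again sums to 1, so summation costs no
  further factor.\<close>

lemma softmax_l1_diff_le:
  assumes I: "finite I" "I \<noteq> {}" and close: "\<And>i. i \<in> I \<Longrightarrow> \<bar>a i - b i\<bar> \<le> \<delta>"
  shows "(\<Sum>i\<in>I. \<bar>softmax I a i - softmax I b i\<bar>) \<le> 2 * \<delta>"
proof -
  have ln_softmax: "ln (softmax I c i) = c i - ln (\<Sum>j\<in>I. exp (c j))" for c i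
  proof -
    have "0 < (\<Sum>j\<in>I. exp (c j))"
      using I by (intro sum_pos) auto
    then show ?thesis by (simp add: softmax_def ln_div)
  qed
  have logs: "\<bar>ln (\<Sum>i\<in>I. exp (a i)) - ln (\<Sum>i\<in>I. exp (b i))\<bar> \<le> \<delta>"
  proof -
    have "a i \<le> b i + \<delta>" "b i \<le> a i + \<delta>" if "i \<in> I" for i
      using close[OF that] by auto
    then show ?thesis
      using ln_sum_exp_diff_le[OF I, of a b \<delta>] ln_sum_exp_diff_le[OF I, of b a \<delta>] by simp
  qed
  have "(\<Sum>i\<in>I. \<bar>softmax I a i - softmax I b i\<bar>)
      \<le> (\<Sum>i\<in>I. 2 * \<delta> * ((softmax I a i + softmax I b i) / 2))"
  proof (rule sum_mono)
    fix i assume "i \<in> I"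
    then have "\<bar>ln (softmax I a i) - ln (softmax I b i)\<bar> \<le> 2 * \<delta>"
      using close[of i] logs unfolding ln_softmax by linarith
    then show "\<bar>softmax I a i - softmax I b i\<bar>
        \<le> 2 * \<delta> * ((softmax I a i + softmax I b i) / 2)"
      using softmax_pos[OF I, of a i] softmax_pos[OF I, of b i]
      by (intro order_trans[OF abs_diff_le_log_diff_mult_mean mult_right_mono]) auto
  qed
  also have "\<dots> = \<delta> * (\<Sum>i\<in>I. softmax I a i + softmax I b i)"
    by (simp add: sum_distrib_left)
  also have "\<dots> = 2 * \<delta>"
    using sum_softmax[OF I] by (simp add: sum.distrib)
  finally show ?thesis .
qed

text \<open>Both weight vectors have total 1, so \<open>c\<close> can be subtracted from every
  \<open>v i\<close> without changing the difference; a radius about \<open>c\<close> thus replaces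
  a bound on the norms.\<close>

lemma softmax_average_diff_le:
  fixes v :: "'i \<Rightarrow> 'v::real_normed_vector"
  assumes I: "finite I" "I \<noteq> {}"
    and close: "\<And>i. i \<in> I \<Longrightarrow> \<bar>a i - b i\<bar> \<le> \<delta>"
    and radius: "\<And>i. i \<in> I \<Longrightarrow> norm (v i - c) \<le> R"
  shows "norm ((\<Sum>i\<in>I. softmax I a i *\<^sub>R v i) - (\<Sum>i\<in>I. softmax I b i *\<^sub>R v i)) \<le> 2 * \<delta> * R"
proof -
  have "R \<ge> 0"
    using I radius norm_ge_zero by (metis ex_in_conv order_trans)
  have "(\<Sum>i\<in>I. (softmax I a i - softmax I b i) *\<^sub>R c) = 0"
    using sum_softmax[OF I] by (simp add: sum_subtractf flip: scaleR_sum_left)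
  then have "(\<Sum>i\<in>I. softmax I a i *\<^sub>R v i) - (\<Sum>i\<in>I. softmax I b i *\<^sub>R v i)
      = (\<Sum>i\<in>I. (softmax I a i - softmax I b i) *\<^sub>R (v i - c))"
    by (simp add: scaleR_diff_left scaleR_diff_right sum_subtractf)
  also have "norm \<dots> \<le> (\<Sum>i\<in>I. \<bar>softmax I a i - softmax I b i\<bar> * R)"
    using radius by (intro sum_norm_le) (auto intro: mult_left_mono)
  also have "\<dots> = (\<Sum>i\<in>I. \<bar>softmax I a i - softmax I b i\<bar>) * R"
    by (simp add: sum_distrib_right)
  also have "\<dots> \<le> 2 * \<delta> * R"
    using softmax_l1_diff_le[OF I close] \<open>R \<ge> 0\<close> by (intro mult_right_mono) auto
  finally show ?thesis .
qed

section \<open>The smooth selector\<close>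

lemma softplus_diff_le: "\<bar>softplus y - softplus z\<bar> \<le> \<bar>y - z\<bar>"
proof -
  have mono: "softplus a \<le> softplus b \<and> softplus b \<le> softplus a + (b - a)"
    if "a \<le> b" for a b
  proof -
    have "1 \<le> exp (b - a)"
      using that by simp
    \<comment> \<open>The right side expands to \<open>exp (b - a) + exp b\<close>; taking
      logarithms gives slope at most 1.\<close>
    then have "1 + exp b \<le> (1 + exp a) * exp (b - a)"
      by (simp add: distrib_right flip: exp_add)
    then have "ln (1 + exp b) \<le> ln ((1 + exp a) * exp (b - a))"
      by (subst ln_le_cancel_iff) (auto simp: add_pos_pos)
    also have "\<dots> = ln (1 + exp a) + (b - a)"
      by (subst ln_mult_pos) (auto intro: add_pos_pos)
    finally show ?thesis
      using that by (simp add: softplus_def add_pos_pos)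
  qed
  show ?thesis
    using mono[of y z] mono[of z y] by linarith
qed

lemma smooth_selector_eq_softmax_average:
  "smooth_selector C J \<tau> \<kappa> F x =
     (\<Sum>\<gamma>\<in>C. softmax C (\<lambda>\<gamma>. J \<gamma> / \<tau> - \<kappa> * softplus (F x \<gamma>)) \<gamma> *\<^sub>R \<gamma>)"
  by (simp add: smooth_selector_def selector_weight_def softmax_def scaleR_sum_right
      divide_inverse mult.commute)

text \<open>Keeps the selected parameters inside the square, the only place where the constraint is
  assumed Lipschitz.\<close>

lemma smooth_selector_in_convex:
  assumes "finite C" "C \<noteq> {}" "C \<subseteq> K" "convex K"
  shows "smooth_selector C J \<tau> \<kappa> F x \<in> K"
  unfolding smooth_selector_eq_softmax_average using assms
  by (intro convex_sum sum_softmax less_imp_le softmax_pos) auto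

lemma norm_diff_centre_le_circumradius:
  fixes l r :: real
  assumes "\<gamma> \<in> {l..r} \<times> {l..r}"
  shows "norm (\<gamma> - ((l + r) / 2, (l + r) / 2)) \<le> sqrt 2 * ((r - l) / 2)"
proof -
  have coord: "(y - (l + r) / 2)\<^sup>2 \<le> ((r - l) / 2)\<^sup>2" if "y \<in> {l..r}" for y
    using that by (intro power2_le_iff_abs_le[THEN iffD2]) (auto simp: abs_le_iff field_simps)
  have "norm (\<gamma> - ((l + r) / 2, (l + r) / 2)) \<le> sqrt (2 * ((r - l) / 2)\<^sup>2)"
    using assms coord[of "fst \<gamma>"] coord[of "snd \<gamma>"]
    by (cases \<gamma>) (auto simp: norm_prod_def intro!: real_sqrt_le_mono)
  \<comment> \<open>Membership of \<gamma> in the square gives \<open>l \<le> r\<close>, so the root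
    of the square carries no absolute value.\<close>
  also have "\<dots> = sqrt 2 * ((r - l) / 2)"
    using assms by (auto simp: real_sqrt_mult)
  finally show ?thesis .
qed

lemma smooth_selector_diff_le:
  fixes l r :: real
  assumes C: "finite C" "C \<noteq> {}" "C \<subseteq> {l..r} \<times> {l..r}"
    and "\<kappa> \<ge> 0"
    and error: "\<And>\<gamma>. \<gamma> \<in> C \<Longrightarrow> \<bar>F x \<gamma> - G x \<gamma>\<bar> \<le> \<epsilon>"
  shows "norm (smooth_selector C J \<tau> \<kappa> F x - smooth_selector C J \<tau> \<kappa> G x)
    \<le> \<kappa> * sqrt 2 * (r - l) * \<epsilon>"
proof -
  have "norm (smooth_selector C J \<tau> \<kappa> F x - smooth_selector C J \<tau> \<kappa> G x)
      \<le> 2 * (\<kappa> * \<epsilon>) * (sqrt 2 * ((r - l) / 2))"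
    unfolding smooth_selector_eq_softmax_average
  proof (rule softmax_average_diff_le[OF C(1,2)])
    fix \<gamma> assume "\<gamma> \<in> C"
    \<comment> \<open>The order is swapped because the loss enters the logit with a minus sign;
      \<open>J \<gamma> / \<tau>\<close> cancels between the two logits.\<close>
    then have "\<bar>softplus (G x \<gamma>) - softplus (F x \<gamma>)\<bar> \<le> \<epsilon>"
      using softplus_diff_le[of "G x \<gamma>" "F x \<gamma>"] error[of \<gamma>] by linarith
    then have "\<kappa> * \<bar>softplus (G x \<gamma>) - softplus (F x \<gamma>)\<bar> \<le> \<kappa> * \<epsilon>"
      using \<open>\<kappa> \<ge> 0\<close> by (rule mult_left_mono)
    then show "\<bar>(J \<gamma> / \<tau> - \<kappa> * softplus (F x \<gamma>)) - (J \<gamma> / \<tau> - \<kappa> * softplus (G x \<gamma>))\<bar> \<le> \<kappa> * \<epsilon>"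
      using \<open>\<kappa> \<ge> 0\<close> by (simp add: abs_mult flip: right_diff_distrib)
  next
    fix \<gamma> assume "\<gamma> \<in> C"
    with C(3) show "norm (\<gamma> - ((l + r) / 2, (l + r) / 2)) \<le> sqrt 2 * ((r - l) / 2)"
      by (intro norm_diff_centre_le_circumradius) auto
  qed
  then show ?thesis by (simp add: mult_ac)
qed

lemma sup_norm_on_leD:
  assumes "sup_norm_on S F \<le> ereal e" "z \<in> S"
  shows "\<bar>F z\<bar> \<le> e"
  using assms by (auto simp: sup_norm_on_def SUP_le_iff)

text \<open>Gives the \<open>GREATEST\<close> term its intended value once a maximiser is
  known.\<close>

lemma cbf_margin_eq:
  assumes "u \<in> U" "\<forall>v\<in>U. cbf_constraint f g h x \<gamma> v \<le> cbf_constraint f g h x \<gamma> u"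
  shows "cbf_margin f g h U x \<gamma> = cbf_constraint f g h x \<gamma> u"
  unfolding cbf_margin_def using assms by (intro Greatest_equality) auto

theorem proposition3:
  fixes f :: "real^'n \<Rightarrow> real^'n"
    and g :: "real^'n \<Rightarrow> real^'m^'n"
    and h :: "real^'n \<Rightarrow> real"
    and X Xop :: "(real^'n) set"
    and U :: "(real^'m) set"
    and \<xi> :: "real^'n \<Rightarrow> real \<Rightarrow> real^'n"
    and \<upsilon> :: "real^'n \<Rightarrow> real \<Rightarrow> real^'m"
    and pos :: "real^'n \<Rightarrow> real^'p"
    and x_obs :: "real^'p"
    and \<Delta>\<theta> :: "real^'n \<Rightarrow> real^'p \<Rightarrow> real"
    and enc :: "real^'n \<Rightarrow> real^'s"
    and Phi_hat :: "real^'s \<Rightarrow> real \<times> real \<Rightarrow> real"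
    and J :: "real \<times> real \<Rightarrow> real"
    and \<Gamma> \<Gamma>cand :: "(real \<times> real) set"
    and d_min d_max \<gamma>_min \<gamma>_max lam1 lam2 \<beta>\<^sub>1 \<beta>\<^sub>2 \<tau>\<^sub>s \<kappa> \<epsilon> L_psi L_Psi L_M :: real
    and \<psi> Phi Phi_pred :: "real^'n \<Rightarrow> real \<times> real \<Rightarrow> real"
    and \<gamma>_hat \<gamma>_true :: "real^'n \<Rightarrow> real \<times> real"
    and \<mu> :: "real^'n \<Rightarrow> real"
  defines "\<Gamma> \<equiv> {\<gamma>_min..\<gamma>_max} \<times> {\<gamma>_min..\<gamma>_max}"
    and "L_M \<equiv> \<kappa> * sqrt 2 * (\<gamma>_max - \<gamma>_min)"
    and "\<psi> \<equiv> \<lambda>x \<gamma>. safety_margin h (\<xi> x) \<gamma>"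
    and "Phi \<equiv> \<lambda>x \<gamma>. safety_loss lam1 lam2 \<beta>\<^sub>1 \<beta>\<^sub>2 (\<psi> x \<gamma>) (dist (pos x) x_obs) (\<Delta>\<theta> x x_obs)"
    and "Phi_pred \<equiv> \<lambda>x \<gamma>. Phi_hat (enc x) \<gamma>"
    and "\<gamma>_hat \<equiv> smooth_selector \<Gamma>cand J \<tau>\<^sub>s \<kappa> Phi_pred"
    and "\<gamma>_true \<equiv> smooth_selector \<Gamma>cand J \<tau>\<^sub>s \<kappa> Phi"
    and "\<mu> \<equiv> \<lambda>x. cbf_margin f g h U x (\<gamma>_true x)"
  assumes h_differentiable: "\<forall>x\<in>X. \<forall>\<^sub>F y in nhds x. h differentiable (at y)"
    and Lfh_differentiable: "\<forall>x\<in>X. lie_derivative f h differentiable (at x)"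
    and Xop: "compact Xop" "Xop \<subseteq> X"
    and trajectories: "\<forall>x\<in>Xop. trajectory_through f g U x (\<xi> x) (\<upsilon> x)"
    and second_derivative: "\<forall>x\<in>Xop. deriv (\<lambda>t. h (\<xi> x t)) differentiable (at 0)"
    and distance: "\<forall>x\<in>Xop. dist (pos x) x_obs \<in> {d_min..d_max}" "d_min > 0"
    and heading: "\<forall>x\<in>Xop. \<Delta>\<theta> x x_obs \<in> {0..pi}"
    and \<gamma>_min: "\<gamma>_min > 0"
    and psi_lipschitz: "\<forall>x\<in>Xop. L_psi-lipschitz_on \<Gamma> (\<psi> x)"
    and candidates: "finite \<Gamma>cand" "\<Gamma>cand \<noteq> {}" "\<Gamma>cand \<subseteq> \<Gamma>"
    and selector_params: "\<tau>\<^sub>s > 0" "\<kappa> > 0"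
    and prediction_error:
      "sup_norm_on (Xop \<times> \<Gamma>) (\<lambda>(x, \<gamma>). Phi_pred x \<gamma> - Phi x \<gamma>) \<le> ereal \<epsilon>"
    and feasible_true: "cbf_qp_feasible_under f g h U Xop \<gamma>_true"
    and max_attained:
      "\<forall>x\<in>Xop. \<exists>u\<in>U. \<forall>v\<in>U.
         cbf_constraint f g h x (\<gamma>_true x) v \<le> cbf_constraint f g h x (\<gamma>_true x) u"
    and margin_pos: "\<forall>x\<in>Xop. \<mu> x > 0"
    and Psi_lipschitz:
      "\<forall>x\<in>Xop. \<forall>\<gamma>\<in>\<Gamma>. \<forall>\<gamma>'\<in>\<Gamma>. \<forall>u\<in>U.
         \<bar>cbf_constraint f g h x \<gamma> u - cbf_constraint f g h x \<gamma>' u\<bar> \<le> L_Psi * norm (\<gamma> - \<gamma>')"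
    and small_error: "L_Psi * L_M * \<epsilon> < (INF x\<in>Xop. \<mu> x)"
  shows "cbf_qp_feasible_under f g h U Xop \<gamma>_hat"
  unfolding cbf_qp_feasible_under_def cbf_qp_feasible_def
proof
  fix x assume x: "x \<in> Xop"
  obtain u where u: "u \<in> U"
    "\<forall>v\<in>U. cbf_constraint f g h x (\<gamma>_true x) v \<le> cbf_constraint f g h x (\<gamma>_true x) u"
    using max_attained x by blast
  \<comment> \<open>A real infimum is a lower bound only for a set bounded below; positivity of the
    margins supplies the bound 0.\<close>
  have "(INF x\<in>Xop. \<mu> x) \<le> \<mu> x"
    using margin_pos x by (intro cINF_lower bdd_belowI2[of _ 0]) (auto intro: less_imp_le)
  then have margin: "L_Psi * L_M * \<epsilon> < cbf_constraint f g h x (\<gamma>_true x) u"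
    using small_error cbf_margin_eq[OF u] by (simp add: \<mu>_def)
  have "convex \<Gamma>"
    by (simp add: \<Gamma>_def convex_Times)
  then have in_\<Gamma>: "\<gamma>_hat x \<in> \<Gamma>" "\<gamma>_true x \<in> \<Gamma>"
    unfolding \<gamma>_hat_def \<gamma>_true_def using candidates
    by (auto intro!: smooth_selector_in_convex)
  have error: "\<bar>Phi_pred x \<gamma> - Phi x \<gamma>\<bar> \<le> \<epsilon>" if "\<gamma> \<in> \<Gamma>" for \<gamma>
    using sup_norm_on_leD[OF prediction_error, of "(x, \<gamma>)"] x that by simp
  have drift: "norm (\<gamma>_true x - \<gamma>_hat x) \<le> L_M * \<epsilon>"
    unfolding \<gamma>_hat_def \<gamma>_true_def L_M_def norm_minus_commute[of "smooth_selector _ _ _ _ Phi x"]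
    using candidates selector_params error
    by (intro smooth_selector_diff_le) (auto simp: \<Gamma>_def)
  have lipschitz: "\<bar>cbf_constraint f g h x \<gamma> u - cbf_constraint f g h x \<gamma>' u\<bar>
      \<le> L_Psi * norm (\<gamma> - \<gamma>')" if "\<gamma> \<in> \<Gamma>" "\<gamma>' \<in> \<Gamma>" for \<gamma> \<gamma>'
    using Psi_lipschitz x u(1) that by blast
  have "L_Psi * norm (\<gamma>_true x - \<gamma>_hat x) \<le> L_Psi * (L_M * \<epsilon>)"
  \<comment> \<open>Scaling \<open>drift\<close> by \<open>L_Psi\<close> preserves the inequality
    only for a nonnegative factor.\<close>
  proof (cases "L_Psi \<ge> 0")
    case True
    with drift show ?thesis by (rule mult_left_mono)
  next
    \<comment> \<open>A negative Lipschitz constant forces \<open>\<Gamma>\<close> to be a single point.\<close>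
    case False
    have "\<gamma> = \<gamma>'" if "\<gamma> \<in> \<Gamma>" "\<gamma>' \<in> \<Gamma>" for \<gamma> \<gamma>'
    proof -
      have "0 \<le> L_Psi * norm (\<gamma> - \<gamma>')"
        using lipschitz[OF that] by linarith
      then show ?thesis
        using False by (auto simp: zero_le_mult_iff)
    qed
    \<comment> \<open>Comparing two opposite corners forces the side length, hence
      \<open>L_M\<close>, to be 0; both sides of the claim then vanish.\<close>
    moreover have "(\<gamma>_min, \<gamma>_min) \<in> \<Gamma>" "(\<gamma>_max, \<gamma>_max) \<in> \<Gamma>"
      using in_\<Gamma>(1) by (auto simp: \<Gamma>_def)
    ultimately have "\<gamma>_min = \<gamma>_max" "\<gamma>_true x = \<gamma>_hat x"
      using in_\<Gamma> by blast+
    then show ?thesis by (simp add: L_M_def)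
  qed
  \<comment> \<open>Passing to the predicted parameter costs at most
    \<open>L_Psi * L_M * \<epsilon>\<close>, less than the value attained by \<open>u\<close> at the
    true one.\<close>
  with lipschitz[OF in_\<Gamma>(2,1)] margin have "0 \<le> cbf_constraint f g h x (\<gamma>_hat x) u"
    by (simp add: mult.assoc abs_le_iff)
  with u(1) show "\<exists>u\<in>U. 0 \<le> cbf_constraint f g h x (\<gamma>_hat x) u" by blast
qed

end
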